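(* Let $\mathcal{A}\in\mathtt{T}^m(\mathbb{R}^n)$ and $\delta>0$. Let $Z(\mathbb{R},\mathcal{A})$ be the set of real $\mathtt{Z}$-eigenvalues of $\mathcal{A}$. Suppose $\lambda_i\in Z(\mathbb{R},\mathcal{A})$ and let $\lambda_{\max}$ be the biggest element of $Z(\mathbb{R},\mathcal{A})$. Put $$\nu_i:=\max\{\lambda\in Z(\mathbb{R},\mathcal{A}):\lambda\le\lambda_i+\delta\},\qquad \omega(\lambda_i+\delta):=\min\{\lambda\in Z(\mathbb{R},\mathcal{A}):\lambda\ge\lambda_i+\delta\}$$ (the latter when the set is nonempty). (i) Suppose $\lambda_i$ is an isolated $\mathtt{Z}$-eigenvalue of $\mathcal{A}$. If $\nu_i=\lambda_i$ and $\lambda_{\max}>\lambda_i$, then $\omega(\lambda_i+\delta)=\lambda_{i+1}$, where $\lambda_{i+1}$ is the smallest real $\mathtt{Z}$-eigenvalue of $\mathcal{A}$ bigger than $\lambda_i$. (ii) If $\nu_i=\lambda_i$ and the semidefinite relaxation $(P_k)$ defined in the context is infeasible for some $k\ge k_0$, then $\lambda_i=\lambda_{\max}$.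
   Context: $\mathtt{T}^m(\mathbb{R}^n)$ is the space of real $m$-order $n$-dimensional tensors $\mathcal{A}=(\mathcal{A}_{i_1\cdots i_m})_{1\le i_1,\ldots,i_m\le n}$ (no symmetry assumed). For $x=(x_1,\ldots,x_n)$, $$\mathcal{A}x^m:=\sum_{i_1,\ldots,i_m}\mathcal{A}_{i_1\cdots i_m}x_{i_1}\cdots x_{i_m},\qquad \mathcal{A}x^{m-1}:=\Big(\sum_{i_2,\ldots,i_m}\mathcal{A}_{j i_2\cdots i_m}x_{i_2}\cdots x_{i_m}\Big)_{j=1,\ldots,n}\ (\text{a vector}).$$ A real $\mathtt{Z}$-eigenpair is $(\lambda,u)\in\mathbb{R}\times\mathbb{R}^n$ with $\mathcal{A}u^{m-1}=\lambda u$, $u^Tu=1$; $\lambda$ is then called a real $\mathtt{Z}$-eigenvalue (both $\lambda$ and $u$ are required to be real). A real $\mathtt{Z}$-eigenvalue $\lambda$ is isolated if there is $\varepsilon>0$ such that no other real $\mathtt{Z}$-eigenvalue $\mu$ satisfies $|\lambda-\mu|<\varepsilon$. Notation for $(P_k)$. $\mathbb{N}_d^n:=\{\alpha\in\mathbb{N}^n:|\alpha|\le d\}$, and $\mathbb{R}^{\mathbb{N}_d^n}$ is the space of real vectors $y=(y_\alpha)$ indexed by $\alpha\in\mathbb{N}_d^n$. For a real polynomial $p=\sum_\alpha p_\alpha x^\alpha$ of degree $\le d$ and $y\in \mathbb{R}^{\mathbb{N}_d^n}$, $\langle p,y\rangle:=\sum_\alpha p_\alpha y_\alpha$. For a real polynomial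 $q$ with $\deg q\le 2k$ and $y\in\mathbb{R}^{\mathbb{N}_{2k}^n}$, the localizing matrix $L_q^{(k)}(y)$ is the symmetric matrix with $\langle qp^2,y\rangle=\mathrm{vec}(p)^TL_q^{(k)}(y)\,\mathrm{vec}(p)$ for all polynomials $p$ with $\deg(qp^2)\le 2k$, where $\mathrm{vec}(p)$ is the coefficient vector of $p$. For a tuple $h$, $L_h^{(k)}(y)=0$ means $L_{h_j}^{(k)}(y)=0$ for every $j$. $M_k(y):=L_1^{(k)}(y)=(y_{\alpha+\beta})_{\alpha,\beta\in\mathbb{N}_k^n}$. $X\succeq0$ means positive semidefinite. Let $f(x):=\mathcal{A}x^m$, $h:=\big(\mathcal{A}x^{m-1}-(\mathcal{A}x^m)x,\ x^Tx-1\big)$ (a tuple of $n+1$ polynomials), $k_0:=\lceil (m+1)/2\rceil$. For integers $k\ge k_0$: $$(P_k)\quad \min\ \langle f,y\rangle\ \text{ s.t. }\ \langle 1,y\rangle=1,\ L_h^{(k)}(y)=0,\ M_k(y)\succeq0,\ L^{(k)}_{f-\lambda_i-\delta}(y)\succeq0,\ y\in\mathbb{R}^{\mathbb{N}_{2k}^n}.$$ *)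

theory Defs
  imports "HOL-Analysis.Analysis" "HOL-Library.Poly_Mapping"
begin

section \<open>Tensors and real Z-eigenvalues\<close>

text \<open>
  A real tensor of order m and dimension n = CARD('n) is a function on multi-indices. A multi-index
  is a list over 'n, and for a tensor of order m only the lists of length m are ever looked at.
\<close>

type_synonym 'n tensor = "'n list \<Rightarrow> real"

definition tensor_form :: "nat \<Rightarrow> 'n::finite tensor \<Rightarrow> real^'n \<Rightarrow> real" where
  "tensor_form m A x = (\<Sum>is | length is = m. A is * (\<Prod>i\<leftarrow>is. x $ i))"

definition tensor_vec :: "nat \<Rightarrow> 'n::finite tensor \<Rightarrow> real^'n \<Rightarrow> real^'n" where
  "tensor_vec m A x = (\<chi> j. \<Sum>is | length is = m - 1. A (j # is) * (\<Prod>i\<leftarrow>is. x $ i))"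

definition Z_eigenpair :: "nat \<Rightarrow> 'n::finite tensor \<Rightarrow> real \<Rightarrow> real^'n \<Rightarrow> bool" where
  "Z_eigenpair m A l u \<longleftrightarrow> tensor_vec m A u = l *\<^sub>R u \<and> u \<bullet> u = 1"

definition Z_eigenvalues :: "nat \<Rightarrow> 'n::finite tensor \<Rightarrow> real set" where
  "Z_eigenvalues m A = {l. \<exists>u. Z_eigenpair m A l u}"

definition isolated_Z_eigenvalue :: "nat \<Rightarrow> 'n::finite tensor \<Rightarrow> real \<Rightarrow> bool" where
  "isolated_Z_eigenvalue m A l \<longleftrightarrow> l \<in> Z_eigenvalues m A \<and>
     (\<exists>\<epsilon>>0. \<not> (\<exists>\<mu>\<in>Z_eigenvalues m A. \<mu> \<noteq> l \<and> \<bar>l - \<mu>\<bar> < \<epsilon>))"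

text \<open>
  The set of real Z-eigenvalues may be infinite, so \<^const>\<open>Max\<close> and \<^const>\<open>Min\<close> are not applicable.
\<close>

definition is_greatest :: "'a::order \<Rightarrow> 'a set \<Rightarrow> bool" where
  "is_greatest a S \<longleftrightarrow> a \<in> S \<and> (\<forall>b\<in>S. b \<le> a)"

definition is_least :: "'a::order \<Rightarrow> 'a set \<Rightarrow> bool" where
  "is_least a S \<longleftrightarrow> a \<in> S \<and> (\<forall>b\<in>S. a \<le> b)"


section \<open>Real polynomials in the variables indexed by 'n\<close>

type_synonym 'n monom = "'n \<Rightarrow>\<^sub>0 nat"
type_synonym 'n rpoly = "'n monom \<Rightarrow>\<^sub>0 real"

definition mdeg :: "'n::finite monom \<Rightarrow> nat" where
  "mdeg \<alpha> = (\<Sum>i\<in>UNIV. Poly_Mapping.lookup \<alpha> i)"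

text \<open>Total degree; the zero polynomial has degree 0 here.\<close>

definition tdeg :: "'n::finite rpoly \<Rightarrow> nat" where
  "tdeg p = Max (insert 0 (mdeg ` Poly_Mapping.keys p))"

definition Const :: "real \<Rightarrow> 'n::finite rpoly" where
  "Const c = Poly_Mapping.single 0 c"

definition Var :: "'n::finite \<Rightarrow> 'n rpoly" where
  "Var i = Poly_Mapping.single (Poly_Mapping.single i 1) 1"

definition form_poly :: "nat \<Rightarrow> 'n::finite tensor \<Rightarrow> 'n rpoly" where
  "form_poly m A = (\<Sum>is | length is = m. Const (A is) * (\<Prod>i\<leftarrow>is. Var i))"

definition vec_poly :: "nat \<Rightarrow> 'n::finite tensor \<Rightarrow> 'n \<Rightarrow> 'n rpoly" where
  "vec_poly m A j = (\<Sum>is | length is = m - 1. Const (A (j # is)) * (\<Prod>i\<leftarrow>is. Var i))"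

definition Z_system :: "nat \<Rightarrow> 'n::finite tensor \<Rightarrow> 'n rpoly set" where
  "Z_system m A = insert ((\<Sum>i\<in>UNIV. Var i * Var i) - 1)
     (range (\<lambda>j. vec_poly m A j - form_poly m A * Var j))"


section \<open>Localizing matrices and the relaxations\<close>

definition monoms :: "nat \<Rightarrow> 'n::finite monom set" where
  "monoms d = {\<alpha>. mdeg \<alpha> \<le> d}"

text \<open>Vectors indexed by monomials of degree at most d, extended by 0 to all monomials.\<close>

definition tms_space :: "nat \<Rightarrow> ('n::finite monom \<Rightarrow> real) set" where
  "tms_space d = {y. \<forall>\<alpha>. \<alpha> \<notin> monoms d \<longrightarrow> y \<alpha> = 0}"

definition riesz :: "'n::finite rpoly \<Rightarrow> ('n monom \<Rightarrow> real) \<Rightarrow> real" where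
  "riesz p y = (\<Sum>\<alpha>\<in>Poly_Mapping.keys p. Poly_Mapping.lookup p \<alpha> * y \<alpha>)"

text \<open>
  For q nonzero of degree at most 2k, the polynomials p with deg (q p^2) at most 2k are exactly those
  of degree at most (2k - deg q) div 2. The monomials of that degree index the localizing matrix;
  the matrix is extended by 0.
\<close>

definition loc_index :: "nat \<Rightarrow> 'n::finite rpoly \<Rightarrow> 'n monom set" where
  "loc_index k q = monoms ((2 * k - tdeg q) div 2)"

definition is_localizing_matrix ::
    "nat \<Rightarrow> 'n::finite rpoly \<Rightarrow> ('n monom \<Rightarrow> real) \<Rightarrow> ('n monom \<Rightarrow> 'n monom \<Rightarrow> real) \<Rightarrow> bool" where
  "is_localizing_matrix k q y L \<longleftrightarrow>
     (\<forall>\<alpha> \<beta>. L \<alpha> \<beta> = L \<beta> \<alpha>) \<and>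
     (\<forall>\<alpha> \<beta>. \<alpha> \<notin> loc_index k q \<longrightarrow> L \<alpha> \<beta> = 0) \<and>
     (\<forall>p. tdeg (q * p\<^sup>2) \<le> 2 * k \<longrightarrow>
        riesz (q * p\<^sup>2) y =
          (\<Sum>\<alpha>\<in>loc_index k q. \<Sum>\<beta>\<in>loc_index k q.
             Poly_Mapping.lookup p \<alpha> * L \<alpha> \<beta> * Poly_Mapping.lookup p \<beta>))"

text \<open>
  Existence and uniqueness for deg q at most 2k are shown in \<open>ex1_localizing_matrix\<close> below,
  the explicit entries in \<open>localizing_matrix_eq\<close>.
\<close>

definition localizing_matrix ::
    "nat \<Rightarrow> 'n::finite rpoly \<Rightarrow> ('n monom \<Rightarrow> real) \<Rightarrow> 'n monom \<Rightarrow> 'n monom \<Rightarrow> real" where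
  "localizing_matrix k q y = (THE L. is_localizing_matrix k q y L)"

definition moment_matrix ::
    "nat \<Rightarrow> ('n::finite monom \<Rightarrow> real) \<Rightarrow> 'n monom \<Rightarrow> 'n monom \<Rightarrow> real" where
  "moment_matrix k y = localizing_matrix k 1 y"

definition psd_on :: "'a set \<Rightarrow> ('a \<Rightarrow> 'a \<Rightarrow> real) \<Rightarrow> bool" where
  "psd_on I M \<longleftrightarrow> (\<forall>a\<in>I. \<forall>b\<in>I. M a b = M b a) \<and>
     (\<forall>v. 0 \<le> (\<Sum>a\<in>I. \<Sum>b\<in>I. v a * M a b * v b))"

definition k0 :: "nat \<Rightarrow> nat" where
  "k0 m = nat \<lceil>(real m + 1) / 2\<rceil>"

text \<open>
  The feasible set of the k-th relaxation at the eigenvalue l with shift \<open>\<delta>\<close>. Its objective,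
  minimising \<open>riesz (form_poly m A) y\<close>, plays no role for infeasibility.
\<close>

definition P_feasible ::
    "nat \<Rightarrow> 'n::finite tensor \<Rightarrow> real \<Rightarrow> real \<Rightarrow> nat \<Rightarrow> ('n monom \<Rightarrow> real) set" where
  "P_feasible m A l \<delta> k = {y \<in> tms_space (2 * k).
     riesz 1 y = 1 \<and>
     (\<forall>h\<in>Z_system m A. localizing_matrix k h y = (\<lambda>_ _. 0)) \<and>
     psd_on (monoms k) (moment_matrix k y) \<and>
     psd_on (loc_index k (form_poly m A - Const l - Const \<delta>))
       (localizing_matrix k (form_poly m A - Const l - Const \<delta>) y)}"


section \<open>Well-definedness of the largest eigenvalues\<close>

lemma compact_Z_eigenvalues:
  fixes A :: "'n::finite tensor"
  assumes "m \<ge> 1"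
  shows "compact (Z_eigenvalues m A)"
proof -
  let ?l = "\<lambda>u. u \<bullet> tensor_vec m A u"
  let ?S = "{u. u \<bullet> u = 1 \<and> tensor_vec m A u = ?l u *\<^sub>R u}"
  have pl: "continuous_on UNIV (\<lambda>u::real^'n. \<Prod>i\<leftarrow>is. u $ i)" for "is"
    by (induction "is") (auto intro!: continuous_intros)
  have cv: "continuous_on UNIV (tensor_vec m A)"
    unfolding tensor_vec_def by (auto intro!: continuous_intros pl)
  have cl: "continuous_on UNIV ?l" by (intro continuous_intros cv)
  have 1: "closed {u::real^'n. u \<bullet> u = 1}"
    by (intro closed_Collect_eq continuous_intros)
  have 2: "closed {u. tensor_vec m A u = ?l u *\<^sub>R u}"
    by (intro closed_Collect_eq continuous_intros cv cl)
  have "closed ?S" using closed_Int[OF 1 2] by (simp add: Collect_conj_eq)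
  moreover have "bounded ?S"
    by (rule bounded_subset[OF bounded_cball[of 0 1]]) (auto simp: norm_eq_sqrt_inner)
  ultimately have "compact ?S" by (simp add: compact_eq_bounded_closed)
  moreover have "Z_eigenvalues m A = ?l ` ?S"
    unfolding Z_eigenvalues_def Z_eigenpair_def by (force simp: image_iff)
  ultimately show ?thesis
    using compact_continuous_image[OF continuous_on_subset[OF cl]] by auto
qed

lemma ex_greatest_Z_eigenvalue:
  assumes "m \<ge> 1" "l \<in> Z_eigenvalues m A" "l \<le> c"
  shows "\<exists>a. is_greatest a (Z_eigenvalues m A)"
    and "\<exists>a. is_greatest a {b \<in> Z_eigenvalues m A. b \<le> c}"
proof -
  note C = compact_Z_eigenvalues[OF assms(1), of A]
  show "\<exists>a. is_greatest a (Z_eigenvalues m A)"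
    using compact_attains_sup[OF C] assms(2) unfolding is_greatest_def by blast
  have "compact (Z_eigenvalues m A \<inter> {..c})" by (intro compact_Int_closed C closed_atMost)
  moreover have "Z_eigenvalues m A \<inter> {..c} = {b \<in> Z_eigenvalues m A. b \<le> c}" by auto
  ultimately have "compact {b \<in> Z_eigenvalues m A. b \<le> c}" by simp
  with compact_attains_sup[OF this] assms(2,3)
  show "\<exists>a. is_greatest a {b \<in> Z_eigenvalues m A. b \<le> c}"
    unfolding is_greatest_def by blast
qed


section \<open>Well-definedness of localizing matrices\<close>

lemma finite_monoms: "finite (monoms d :: 'n::finite monom set)"
proof -
  have "Poly_Mapping.lookup ` (monoms d :: 'n monom set) \<subseteq> (UNIV :: 'n set) \<rightarrow>\<^sub>E {..d}"
  proof (clarsimp simp: monoms_def mdeg_def PiE_UNIV_domain)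
    fix \<alpha> :: "'n monom" and i
    assume "(\<Sum>i\<in>UNIV. Poly_Mapping.lookup \<alpha> i) \<le> d"
    moreover have "Poly_Mapping.lookup \<alpha> i \<le> (\<Sum>i\<in>UNIV. Poly_Mapping.lookup \<alpha> i)"
      by (rule member_le_sum) auto
    ultimately show "Poly_Mapping.lookup \<alpha> i \<le> d" by simp
  qed
  then have "finite (Poly_Mapping.lookup ` (monoms d :: 'n monom set))"
    by (rule finite_subset) (auto intro!: finite_PiE)
  then show ?thesis by (rule finite_imageD) (auto simp: inj_on_def Poly_Mapping.lookup_inject)
qed

lemma mdeg_add: "mdeg (\<alpha> + \<beta>) = mdeg \<alpha> + mdeg \<beta>"
  by (simp add: mdeg_def lookup_add sum.distrib)

lemma mdeg_le_tdeg: "\<alpha> \<in> Poly_Mapping.keys p \<Longrightarrow> mdeg \<alpha> \<le> tdeg p"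
  unfolding tdeg_def by (rule Max_ge) auto

lemma tdeg_le_iff: "tdeg p \<le> d \<longleftrightarrow> Poly_Mapping.keys p \<subseteq> monoms d"
  unfolding tdeg_def monoms_def by (subst Max_le_iff) auto

lemma poly_expand: "p = (\<Sum>\<alpha>\<in>Poly_Mapping.keys p. Poly_Mapping.single \<alpha> (Poly_Mapping.lookup p \<alpha>))"
  by (rule poly_mapping_eqI)
     (auto simp: lookup_sum lookup_single when_def in_keys_iff sum.delta' cong: if_cong)

lemma tdeg_mult_le: "tdeg (p * q) \<le> tdeg p + tdeg q"
proof -
  have "Poly_Mapping.keys (p * q) \<subseteq> monoms (tdeg p + tdeg q)"
    using keys_mult[of p q] mdeg_le_tdeg
    by (fastforce simp: monoms_def mdeg_add intro: add_mono)
  then show ?thesis by (simp add: tdeg_le_iff)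
qed

lemma riesz_superset:
  assumes "finite S" "Poly_Mapping.keys p \<subseteq> S"
  shows "riesz p y = (\<Sum>\<alpha>\<in>S. Poly_Mapping.lookup p \<alpha> * y \<alpha>)"
  unfolding riesz_def using assms
  by (intro sum.mono_neutral_left) (auto simp: in_keys_iff)

lemma riesz_0: "riesz 0 y = 0" by (simp add: riesz_def)

lemma riesz_add: "riesz (p + q) y = riesz p y + riesz q y"
proof -
  let ?S = "Poly_Mapping.keys p \<union> Poly_Mapping.keys q"
  have "riesz (p + q) y = (\<Sum>\<alpha>\<in>?S. Poly_Mapping.lookup (p + q) \<alpha> * y \<alpha>)"
    by (rule riesz_superset) (auto dest: subsetD[OF Poly_Mapping.keys_add])
  also have "\<dots> = riesz p y + riesz q y"
    by (simp add: lookup_add algebra_simps sum.distrib riesz_superset[of ?S])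
  finally show ?thesis .
qed

lemma riesz_sum: "riesz (sum f S) y = (\<Sum>s\<in>S. riesz (f s) y)"
  by (induction S rule: infinite_finite_induct) (auto simp: riesz_0 riesz_add)

lemma riesz_single: "riesz (Poly_Mapping.single \<alpha> c) y = c * y \<alpha>"
  by (simp add: riesz_def)

lemma mult_expand:
  "p * q = (\<Sum>\<alpha>\<in>Poly_Mapping.keys p. \<Sum>\<beta>\<in>Poly_Mapping.keys q.
     Poly_Mapping.single (\<alpha> + \<beta>) (Poly_Mapping.lookup p \<alpha> * Poly_Mapping.lookup q \<beta>))"
proof -
  have "p * q = (\<Sum>\<alpha>\<in>Poly_Mapping.keys p. Poly_Mapping.single \<alpha> (Poly_Mapping.lookup p \<alpha>)) *
      (\<Sum>\<beta>\<in>Poly_Mapping.keys q. Poly_Mapping.single \<beta> (Poly_Mapping.lookup q \<beta>))"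
    using poly_expand[of p] poly_expand[of q] by metis
  then show ?thesis by (simp only: sum_product mult_single)
qed

lemma riesz_mult:
  "riesz (p * q) y = (\<Sum>\<alpha>\<in>Poly_Mapping.keys p. \<Sum>\<beta>\<in>Poly_Mapping.keys q.
     Poly_Mapping.lookup p \<alpha> * Poly_Mapping.lookup q \<beta> * y (\<alpha> + \<beta>))"
  by (subst mult_expand) (simp add: riesz_sum riesz_single)

lemma lookup_mult_expand:
  "Poly_Mapping.lookup (p * q) \<gamma> = (\<Sum>\<alpha>\<in>Poly_Mapping.keys p. \<Sum>\<beta>\<in>Poly_Mapping.keys q.
     Poly_Mapping.lookup p \<alpha> * Poly_Mapping.lookup q \<beta> when \<alpha> + \<beta> = \<gamma>)"
  by (subst mult_expand) (simp add: lookup_sum lookup_single)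

text \<open>
  An additive embedding of the monomials into a linearly ordered monoid that refines the degree,
  i.e. a graded monomial order; used to see that the degree of a product is the sum of the degrees.
\<close>

definition grd :: "'n::finite monom \<Rightarrow> (nat \<Rightarrow>\<^sub>0 nat)" where
  "grd \<alpha> = Poly_Mapping.single 0 (mdeg \<alpha>) +
     (\<Sum>i\<in>UNIV. Poly_Mapping.single (Suc (to_nat_on UNIV i)) (Poly_Mapping.lookup \<alpha> i))"

lemma grd_add: "grd (\<alpha> + \<beta>) = grd \<alpha> + grd \<beta>"
  by (simp add: grd_def mdeg_add lookup_add single_add sum.distrib ac_simps)

lemma lookup_grd_0: "Poly_Mapping.lookup (grd \<alpha>) 0 = mdeg \<alpha>"
  by (simp add: grd_def lookup_add lookup_sum lookup_single)

lemma lookup_grd_Suc: "Poly_Mapping.lookup (grd \<alpha>) (Suc (to_nat_on UNIV i)) = Poly_Mapping.lookup \<alpha> i"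
proof -
  have inj: "to_nat_on UNIV a = to_nat_on UNIV i \<longleftrightarrow> a = i" for a :: 'a
    using inj_on_to_nat_on[of "UNIV :: 'a set"] by (auto simp: inj_on_def countable_finite)
  show ?thesis
    by (simp add: grd_def lookup_add lookup_sum lookup_single when_def inj)
qed

lemma grd_inj: "grd \<alpha> = grd \<beta> \<Longrightarrow> \<alpha> = \<beta>"
  by (rule poly_mapping_eqI) (metis lookup_grd_Suc)

lemma grd_le_mdeg: "grd \<alpha> \<le> grd \<beta> \<Longrightarrow> mdeg \<alpha> \<le> mdeg \<beta>"
proof (rule ccontr)
  assume "grd \<alpha> \<le> grd \<beta>" "\<not> mdeg \<alpha> \<le> mdeg \<beta>"
  moreover from this(2) have "grd \<beta> < grd \<alpha>"
    by (auto simp: less_poly_mapping.rep_eq less_fun_def lookup_grd_0 intro!: exI[of _ 0])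
  ultimately show False by simp
qed

lemma tdeg_mult:
  assumes "p \<noteq> 0" "q \<noteq> 0"
  shows "tdeg (p * q) = tdeg p + tdeg q" and "p * q \<noteq> 0"
proof -
  have lead: "\<exists>a\<in>Poly_Mapping.keys p. (\<forall>b\<in>Poly_Mapping.keys p. grd b \<le> grd a) \<and> tdeg p = mdeg a"
    if "p \<noteq> 0" for p :: "'a rpoly"
  proof -
    have ne: "Poly_Mapping.keys p \<noteq> {}" using that poly_expand[of p] by auto
    have "Max (grd ` Poly_Mapping.keys p) \<in> grd ` Poly_Mapping.keys p" using ne by simp
    then obtain a where a: "a \<in> Poly_Mapping.keys p" "grd a = Max (grd ` Poly_Mapping.keys p)"
      by auto
    then have b: "\<forall>b\<in>Poly_Mapping.keys p. grd b \<le> grd a" by auto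
    then have "tdeg p \<le> mdeg a" by (auto simp: tdeg_le_iff monoms_def intro: grd_le_mdeg)
    with a b mdeg_le_tdeg[OF a(1)] show ?thesis by fastforce
  qed
  obtain a where a: "a \<in> Poly_Mapping.keys p" "\<And>b. b \<in> Poly_Mapping.keys p \<Longrightarrow> grd b \<le> grd a"
    "tdeg p = mdeg a" using lead[OF assms(1)] by blast
  obtain c where c: "c \<in> Poly_Mapping.keys q" "\<And>b. b \<in> Poly_Mapping.keys q \<Longrightarrow> grd b \<le> grd c"
    "tdeg q = mdeg c" using lead[OF assms(2)] by blast
  have uniq: "x + y = a + c \<longleftrightarrow> x = a \<and> y = c"
    if "x \<in> Poly_Mapping.keys p" "y \<in> Poly_Mapping.keys q" for x y
  proof
    assume e: "x + y = a + c"
    then have g: "grd x + grd y = grd a + grd c" by (metis grd_add)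
    have "grd x = grd a"
    proof (rule ccontr)
      assume "grd x \<noteq> grd a"
      then have "grd x < grd a" using a(2)[OF that(1)] by simp
      then have "grd x + grd y < grd a + grd c" using c(2)[OF that(2)] by (rule add_less_le_mono)
      then show False using g by simp
    qed
    then have "x = a" by (rule grd_inj)
    with e show "x = a \<and> y = c" by simp
  qed auto
  have "Poly_Mapping.lookup (p * q) (a + c) = (\<Sum>\<alpha>\<in>Poly_Mapping.keys p. \<Sum>\<beta>\<in>Poly_Mapping.keys q.
     if \<alpha> = a then if \<beta> = c then Poly_Mapping.lookup p a * Poly_Mapping.lookup q c else 0 else 0)"
    unfolding lookup_mult_expand by (intro sum.cong refl) (auto simp: when_def uniq)
  also have "\<dots> = (\<Sum>\<alpha>\<in>Poly_Mapping.keys p.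
     if \<alpha> = a then Poly_Mapping.lookup p a * Poly_Mapping.lookup q c else 0)"
    using c(1) by (intro sum.cong refl) auto
  also have "\<dots> = Poly_Mapping.lookup p a * Poly_Mapping.lookup q c"
    using a(1) by simp
  finally have "Poly_Mapping.lookup (p * q) (a + c) \<noteq> 0"
    using a(1) c(1) by (simp add: in_keys_iff)
  then have k: "a + c \<in> Poly_Mapping.keys (p * q)" by (simp add: in_keys_iff)
  show "tdeg (p * q) = tdeg p + tdeg q"
    using mdeg_le_tdeg[OF k] tdeg_mult_le[of p q] by (simp add: mdeg_add a c)
  show "p * q \<noteq> 0" using k by auto
qed

lemma keys_loc_index:
  assumes "q \<noteq> 0" "tdeg q \<le> 2 * k"
  shows "tdeg (q * p\<^sup>2) \<le> 2 * k \<longleftrightarrow> Poly_Mapping.keys p \<subseteq> loc_index k q"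
proof (cases "p = 0")
  case False
  then have "tdeg (q * p\<^sup>2) = tdeg q + 2 * tdeg p"
    using assms by (simp add: power2_eq_square tdeg_mult)
  then have "tdeg (q * p\<^sup>2) \<le> 2 * k \<longleftrightarrow> tdeg p \<le> (2 * k - tdeg q) div 2"
    using assms(2) by linarith
  then show ?thesis by (simp add: tdeg_le_iff loc_index_def)
qed (simp add: tdeg_def)

lemma riesz_localizing:
  assumes "finite I" "Poly_Mapping.keys p \<subseteq> I"
  shows "riesz (q * p\<^sup>2) y = (\<Sum>\<alpha>\<in>I. \<Sum>\<beta>\<in>I. Poly_Mapping.lookup p \<alpha> *
     (\<Sum>\<gamma>\<in>Poly_Mapping.keys q. Poly_Mapping.lookup q \<gamma> * y (\<alpha> + \<beta> + \<gamma>)) *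
     Poly_Mapping.lookup p \<beta>)"
proof -
  let ?q = "Poly_Mapping.lookup q" and ?p = "Poly_Mapping.lookup p"
  let ?K = "Poly_Mapping.keys q" and ?J = "Poly_Mapping.keys p"
  define z where "z \<gamma> = (\<lambda>\<beta>. y (\<gamma> + \<beta>))" for \<gamma>
  have "riesz (q * p\<^sup>2) y = (\<Sum>\<gamma>\<in>?K. ?q \<gamma> * riesz (p * p) (z \<gamma>))"
    by (simp add: riesz_mult[of q] power2_eq_square riesz_def[of "p * p"] z_def sum_distrib_left mult.assoc)
  also have "\<dots> = (\<Sum>\<gamma>\<in>?K. \<Sum>\<alpha>\<in>?J. \<Sum>\<beta>\<in>?J. ?q \<gamma> * (?p \<alpha> * ?p \<beta> * y (\<gamma> + (\<alpha> + \<beta>))))"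
    by (simp add: riesz_mult z_def sum_distrib_left)
  also have "\<dots> = (\<Sum>\<alpha>\<in>?J. \<Sum>\<gamma>\<in>?K. \<Sum>\<beta>\<in>?J. ?q \<gamma> * (?p \<alpha> * ?p \<beta> * y (\<gamma> + (\<alpha> + \<beta>))))"
    by (rule sum.swap)
  also have "\<dots> = (\<Sum>\<alpha>\<in>?J. \<Sum>\<beta>\<in>?J. \<Sum>\<gamma>\<in>?K. ?q \<gamma> * (?p \<alpha> * ?p \<beta> * y (\<gamma> + (\<alpha> + \<beta>))))"
    by (rule sum.cong[OF refl], rule sum.swap)
  also have "\<dots> = (\<Sum>\<alpha>\<in>?J. \<Sum>\<beta>\<in>?J. ?p \<alpha> * (\<Sum>\<gamma>\<in>?K. ?q \<gamma> * y (\<alpha> + \<beta> + \<gamma>)) * ?p \<beta>)"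
  proof (rule sum.cong[OF refl], rule sum.cong[OF refl])
    fix \<alpha> \<beta>
    have "?p \<alpha> * (\<Sum>\<gamma>\<in>?K. ?q \<gamma> * y (\<alpha> + \<beta> + \<gamma>)) * ?p \<beta> =
        (\<Sum>\<gamma>\<in>?K. ?p \<alpha> * (?q \<gamma> * y (\<alpha> + \<beta> + \<gamma>)) * ?p \<beta>)"
      by (simp only: sum_distrib_left sum_distrib_right)
    also have "\<dots> = (\<Sum>\<gamma>\<in>?K. ?q \<gamma> * (?p \<alpha> * ?p \<beta> * y (\<gamma> + (\<alpha> + \<beta>))))"
      by (rule sum.cong[OF refl]) (simp add: ac_simps)
    finally show "(\<Sum>\<gamma>\<in>?K. ?q \<gamma> * (?p \<alpha> * ?p \<beta> * y (\<gamma> + (\<alpha> + \<beta>)))) =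
        ?p \<alpha> * (\<Sum>\<gamma>\<in>?K. ?q \<gamma> * y (\<alpha> + \<beta> + \<gamma>)) * ?p \<beta>" by simp
  qed
  also have "\<dots> = (\<Sum>\<alpha>\<in>?J. \<Sum>\<beta>\<in>I. ?p \<alpha> * (\<Sum>\<gamma>\<in>?K. ?q \<gamma> * y (\<alpha> + \<beta> + \<gamma>)) * ?p \<beta>)"
    using assms by (intro sum.cong refl sum.mono_neutral_left) (auto simp: in_keys_iff)
  also have "\<dots> = (\<Sum>\<alpha>\<in>I. \<Sum>\<beta>\<in>I. ?p \<alpha> * (\<Sum>\<gamma>\<in>?K. ?q \<gamma> * y (\<alpha> + \<beta> + \<gamma>)) * ?p \<beta>)"
    using assms by (intro sum.mono_neutral_left) (auto simp: in_keys_iff)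
  finally show ?thesis .
qed

definition loc_entries ::
    "nat \<Rightarrow> 'n::finite rpoly \<Rightarrow> ('n monom \<Rightarrow> real) \<Rightarrow> 'n monom \<Rightarrow> 'n monom \<Rightarrow> real" where
  "loc_entries k q y = (\<lambda>\<alpha> \<beta>. if \<alpha> \<in> loc_index k q \<and> \<beta> \<in> loc_index k q
     then \<Sum>\<gamma>\<in>Poly_Mapping.keys q. Poly_Mapping.lookup q \<gamma> * y (\<alpha> + \<beta> + \<gamma>) else 0)"

lemma is_localizing_matrix_entries:
  assumes "tdeg q \<le> 2 * k"
  shows "is_localizing_matrix k q y (loc_entries k q y)"
  unfolding is_localizing_matrix_def
proof (intro conjI allI impI)
  fix p :: "'a rpoly"
  assume d: "tdeg (q * p\<^sup>2) \<le> 2 * k"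
  show "riesz (q * p\<^sup>2) y = (\<Sum>\<alpha>\<in>loc_index k q. \<Sum>\<beta>\<in>loc_index k q.
     Poly_Mapping.lookup p \<alpha> * loc_entries k q y \<alpha> \<beta> * Poly_Mapping.lookup p \<beta>)"
  proof (cases "q = 0")
    case True
    then show ?thesis by (simp add: riesz_0 loc_entries_def)
  next
    case False
    then have "Poly_Mapping.keys p \<subseteq> loc_index k q" using d assms keys_loc_index by blast
    moreover have "finite (loc_index k q)" by (simp add: loc_index_def finite_monoms)
    ultimately show ?thesis by (simp add: riesz_localizing loc_entries_def cong: sum.cong)
  qed
qed (auto simp: loc_entries_def ac_simps)

lemma is_localizing_matrix_unique:
  assumes q: "tdeg q \<le> 2 * k" and L: "is_localizing_matrix k q y L" "is_localizing_matrix k q y L'"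
  shows "L = L'"
proof (intro ext)
  fix \<alpha> \<beta>
  let ?I = "loc_index k q"
  define D where "D a b = L a b - L' a b" for a b
  have fin: "finite ?I" by (simp add: loc_index_def finite_monoms)
  have "L a b = L b a" "L' a b = L' b a" for a b
    using L unfolding is_localizing_matrix_def by blast+
  then have sym: "D a b = D b a" for a b
    by (simp only: D_def)
  have out: "D a b = 0" if "a \<notin> ?I" for a b
    using L that unfolding is_localizing_matrix_def D_def by simp
  have quad: "(\<Sum>a\<in>?I. \<Sum>b\<in>?I. Poly_Mapping.lookup p a * D a b * Poly_Mapping.lookup p b) = 0"
    if "Poly_Mapping.keys p \<subseteq> ?I" for p
  proof -
    have "tdeg (q * p\<^sup>2) \<le> 2 * k"
    proof (cases "q = 0")
      case False
      then show ?thesis using keys_loc_index[OF _ q] that by blast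
    qed (simp add: tdeg_def)
    then have "riesz (q * p\<^sup>2) y = (\<Sum>a\<in>?I. \<Sum>b\<in>?I. Poly_Mapping.lookup p a * M a b * Poly_Mapping.lookup p b)"
      if "is_localizing_matrix k q y M" for M
      using that unfolding is_localizing_matrix_def by blast
    from this[OF L(1)] this[OF L(2)] show ?thesis
      by (simp only: D_def left_diff_distrib right_diff_distrib sum_subtractf)
  qed
  have diag: "D a a = 0" if "a \<in> ?I" for a
  proof -
    have "(\<Sum>x\<in>?I. \<Sum>b\<in>?I. Poly_Mapping.lookup (Poly_Mapping.single a (1::real)) x * D x b *
       Poly_Mapping.lookup (Poly_Mapping.single a 1) b) =
       (\<Sum>x\<in>?I. \<Sum>b\<in>?I. if b = a then if x = a then D x b else 0 else 0)"
      by (intro sum.cong refl) (auto simp: lookup_single when_def)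
    also have "\<dots> = D a a" using fin that by simp
    finally show ?thesis using quad[of "Poly_Mapping.single a 1"] that by simp
  qed
  have "D \<alpha> \<beta> = 0"
  proof (cases "\<alpha> \<in> ?I \<and> \<beta> \<in> ?I \<and> \<alpha> \<noteq> \<beta>")
    case True
    let ?p = "Poly_Mapping.single \<alpha> (1::real) + Poly_Mapping.single \<beta> 1"
    have "Poly_Mapping.keys ?p \<subseteq> ?I"
      using True Poly_Mapping.keys_add[of "Poly_Mapping.single \<alpha> (1::real)" "Poly_Mapping.single \<beta> 1"]
      by auto
    from quad[OF this] have
      "0 = (\<Sum>a\<in>?I. \<Sum>b\<in>?I. Poly_Mapping.lookup ?p a * D a b * Poly_Mapping.lookup ?p b)" by simp
    also have "\<dots> = (\<Sum>a\<in>?I. Poly_Mapping.lookup ?p a *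
        (\<Sum>b\<in>?I. (if b = \<alpha> then D a b else 0) + (if b = \<beta> then D a b else 0)))"
      unfolding sum_distrib_left
      by (intro sum.cong refl) (auto simp: lookup_add lookup_single when_def)
    also have "\<dots> = (\<Sum>a\<in>?I. Poly_Mapping.lookup ?p a * (D a \<alpha> + D a \<beta>))"
      using fin True by (simp add: sum.distrib)
    also have "\<dots> = (\<Sum>a\<in>?I. (if a = \<alpha> then D a \<alpha> + D a \<beta> else 0) + (if a = \<beta> then D a \<alpha> + D a \<beta> else 0))"
      by (intro sum.cong refl) (auto simp: lookup_add lookup_single when_def)
    also have "\<dots> = D \<alpha> \<alpha> + D \<alpha> \<beta> + (D \<beta> \<alpha> + D \<beta> \<beta>)"
      using fin True by (simp add: sum.distrib)
    finally show ?thesis using diag[of \<alpha>] diag[of \<beta>] sym[of \<alpha> \<beta>] True by simp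
  next
    case False
    then consider "\<alpha> \<notin> ?I" | "\<beta> \<notin> ?I" | "\<alpha> \<in> ?I" "\<alpha> = \<beta>" by blast
    then show ?thesis
    proof cases
      case 2
      then show ?thesis using out[of \<beta> \<alpha>] sym[of \<alpha> \<beta>] by simp
    qed (use out diag in auto)
  qed
  then show "L \<alpha> \<beta> = L' \<alpha> \<beta>" by (simp add: D_def)
qed

lemma ex1_localizing_matrix:
  "tdeg q \<le> 2 * k \<Longrightarrow> \<exists>!L. is_localizing_matrix k q y L"
  using is_localizing_matrix_entries is_localizing_matrix_unique by blast

lemma localizing_matrix_eq:
  "tdeg q \<le> 2 * k \<Longrightarrow> localizing_matrix k q y = loc_entries k q y"
  unfolding localizing_matrix_def
  by (rule the_equality) (auto intro: is_localizing_matrix_entries is_localizing_matrix_unique)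

lemma moment_matrix_eq:
  "moment_matrix k y = (\<lambda>\<alpha> \<beta>. if \<alpha> \<in> monoms k \<and> \<beta> \<in> monoms k then y (\<alpha> + \<beta>) else 0)"
proof -
  have t: "tdeg (1 :: 'a rpoly) = 0" by (simp add: tdeg_def mdeg_def)
  show ?thesis
    by (intro ext) (auto simp: moment_matrix_def localizing_matrix_eq t loc_entries_def loc_index_def)
qed

text \<open>All polynomials entering the relaxations of order at least \<open>k0 m\<close> have degree at most 2k.\<close>

lemma tdeg_add_le: "tdeg p \<le> d \<Longrightarrow> tdeg q \<le> d \<Longrightarrow> tdeg (p + q) \<le> d"
  using Poly_Mapping.keys_add[of p q] by (auto simp: tdeg_le_iff)

lemma tdeg_diff_le:
  assumes "tdeg p \<le> d" "tdeg q \<le> d"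
  shows "tdeg (p - q) \<le> d"
proof -
  have "Poly_Mapping.keys (p - q) \<subseteq> Poly_Mapping.keys p \<union> Poly_Mapping.keys q"
    by (auto simp: in_keys_iff lookup_minus)
  then show ?thesis using assms by (auto simp: tdeg_le_iff)
qed

lemma tdeg_sum_le: "(\<And>s. s \<in> S \<Longrightarrow> tdeg (f s) \<le> d) \<Longrightarrow> tdeg (sum f S) \<le> d"
  by (induction S rule: infinite_finite_induct) (auto simp: tdeg_add_le, auto simp: tdeg_def)

lemma tdeg_Const [simp]: "tdeg (Const c) = 0"
  by (simp add: tdeg_def Const_def mdeg_def)

lemma tdeg_one [simp]: "tdeg 1 = 0"
  by (simp add: tdeg_def mdeg_def)

lemma tdeg_Var_le: "tdeg (Var i) \<le> 1"
  by (simp add: tdeg_def Var_def mdeg_def lookup_single when_def)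

lemma tdeg_prod_Var_le: "tdeg (\<Prod>i\<leftarrow>is. Var i) \<le> length is"
proof (induction "is")
  case (Cons i "is")
  show ?case
    using tdeg_mult_le[of "Var i" "\<Prod>i\<leftarrow>is. Var i"] tdeg_Var_le[of i] Cons by simp
qed simp

lemma tdeg_term_le: "length is = d \<Longrightarrow> tdeg (Const c * (\<Prod>i\<leftarrow>is. Var i)) \<le> d"
  using tdeg_mult_le[of "Const c" "\<Prod>i\<leftarrow>is. Var i"] tdeg_prod_Var_le[of "is"] by simp

lemma tdeg_form_poly_le: "tdeg (form_poly m A) \<le> m"
  unfolding form_poly_def by (rule tdeg_sum_le) (auto intro: tdeg_term_le)

lemma tdeg_vec_poly_le: "tdeg (vec_poly m A j) \<le> m - 1"
  unfolding vec_poly_def by (rule tdeg_sum_le) (auto intro: tdeg_term_le)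

lemma tdeg_Z_system_le:
  assumes "m \<ge> 1" "h \<in> Z_system m A"
  shows "tdeg h \<le> m + 1"
proof -
  have "tdeg (\<Sum>i\<in>UNIV. Var i * Var i :: 'a rpoly) \<le> m + 1"
  proof (rule tdeg_sum_le)
    fix i :: 'a
    show "tdeg (Var i * Var i) \<le> m + 1"
      using tdeg_mult_le[of "Var i" "Var i"] tdeg_Var_le[of i] assms(1) by simp
  qed
  moreover have "tdeg (form_poly m A * Var j) \<le> m + 1" for j
    using tdeg_mult_le[of "form_poly m A" "Var j"] tdeg_Var_le[of j] tdeg_form_poly_le[of m A] by simp
  moreover have "tdeg (vec_poly m A j) \<le> m + 1" for j
    using tdeg_vec_poly_le[of m A j] by simp
  ultimately show ?thesis
    using assms(2) by (auto simp: Z_system_def intro!: tdeg_diff_le)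
qed

lemma tdeg_form_minus_le: "tdeg (form_poly m A - Const l - Const \<delta>) \<le> m"
  by (intro tdeg_diff_le tdeg_form_poly_le) auto

lemma k0_le_iff: "k0 m \<le> k \<longleftrightarrow> m + 1 \<le> 2 * k"
  unfolding k0_def by (simp add: nat_le_iff ceiling_le_iff) linarith

end

theory Submission
  imports Defs
begin

text \<open>
  Part (i) holds because there is no eigenvalue in the interval from \<open>l\<^sub>i\<close> (exclusive) to
  \<open>l\<^sub>i + \<delta>\<close> (inclusive), so both sets in question coincide; they have a least element by
  compactness. For (ii), if \<open>l\<^sub>i\<close> were not the largest eigenvalue, then \<open>l\<^sub>m\<^sub>a\<^sub>x > l\<^sub>i + \<delta>\<close>,
  and the truncated moment sequence of the Dirac measure at a unit eigenvector for \<open>l\<^sub>m\<^sub>a\<^sub>x\<close> would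
  be feasible for every relaxation.
\<close>

text \<open>As a function of \<alpha>, this is the untruncated moment sequence of the Dirac measure
  at \<open>x\<close>.\<close>

definition monom_eval :: "real^'n::finite \<Rightarrow> 'n monom \<Rightarrow> real" where
  "monom_eval x \<alpha> = (\<Prod>i\<in>UNIV. x $ i ^ Poly_Mapping.lookup \<alpha> i)"

lemma monom_eval_0 [simp]: "monom_eval x 0 = 1"
  by (simp add: monom_eval_def)

lemma monom_eval_add: "monom_eval x (\<alpha> + \<beta>) = monom_eval x \<alpha> * monom_eval x \<beta>"
  by (simp add: monom_eval_def lookup_add power_add prod.distrib)

lemma monom_eval_single: "monom_eval x (Poly_Mapping.single i 1) = x $ i"
proof -
  have "monom_eval x (Poly_Mapping.single i 1) = (\<Prod>j\<in>UNIV. if j = i then x $ j else 1)"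
    unfolding monom_eval_def by (rule prod.cong) (auto simp: lookup_single when_def)
  then show ?thesis by simp
qed

text \<open>Point evaluation, phrased through the Riesz functional so that additivity is inherited
  from \<open>riesz_add\<close>, multiplicativity follows from \<open>riesz_mult\<close> and
  \<open>monom_eval_add\<close>, and values compare directly with localizing matrix entries.\<close>

definition poly_eval :: "'n::finite rpoly \<Rightarrow> real^'n \<Rightarrow> real" where
  "poly_eval p x = riesz p (monom_eval x)"

lemma poly_eval_add: "poly_eval (p + q) x = poly_eval p x + poly_eval q x"
  by (simp add: poly_eval_def riesz_add)

lemma poly_eval_diff: "poly_eval (p - q) x = poly_eval p x - poly_eval q x"
  using poly_eval_add[of "p - q" q x] by simp

lemma poly_eval_sum: "poly_eval (sum f S) x = (\<Sum>s\<in>S. poly_eval (f s) x)"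
  by (simp add: poly_eval_def riesz_sum)

lemma poly_eval_mult: "poly_eval (p * q) x = poly_eval p x * poly_eval q x"
  by (simp add: poly_eval_def riesz_mult riesz_def[of p] riesz_def[of q] sum_product
      monom_eval_add ac_simps)

lemma poly_eval_Const [simp]: "poly_eval (Const c) x = c"
  by (simp add: poly_eval_def Const_def riesz_single)

lemma poly_eval_1 [simp]: "poly_eval 1 x = 1"
  by (simp add: poly_eval_def riesz_def)

lemma poly_eval_Var [simp]: "poly_eval (Var i) x = x $ i"
  by (simp add: poly_eval_def Var_def riesz_single monom_eval_single[simplified])

lemma poly_eval_prod_Var: "poly_eval (\<Prod>i\<leftarrow>is. Var i) x = (\<Prod>i\<leftarrow>is. x $ i)"
  by (induction "is") (simp_all add: poly_eval_mult)

lemma poly_eval_form_poly: "poly_eval (form_poly m A) x = tensor_form m A x"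
  by (simp add: form_poly_def tensor_form_def poly_eval_sum poly_eval_mult poly_eval_prod_Var)

lemma poly_eval_vec_poly: "poly_eval (vec_poly m A j) x = tensor_vec m A x $ j"
  by (simp add: vec_poly_def tensor_vec_def poly_eval_sum poly_eval_mult poly_eval_prod_Var)

text \<open>Split the first index off each multi-index and sum over it last. For
  \<open>m \<ge> 1\<close> every list of length \<open>m\<close> is uniquely a head followed by a
  tail of length \<open>m - 1\<close>.\<close>

lemma tensor_form_eq_inner:
  assumes "m \<ge> 1"
  shows "tensor_form m A x = x \<bullet> tensor_vec m A x"
proof -
  let ?g = "\<lambda>is. A is * (\<Prod>i\<leftarrow>is. x $ i)"
  let ?L = "{js :: 'a list. length js = m - 1}"
  have inj: "inj_on (\<lambda>(j, js). j # js) (UNIV \<times> ?L)"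
    by (auto simp: inj_on_def)
  have lists: "{is :: 'a list. length is = m} = (\<lambda>(j, js). j # js) ` (UNIV \<times> ?L)"
  proof (intro set_eqI iffI)
    fix "is" :: "'a list"
    assume "is \<in> {is. length is = m}"
    with assms obtain j js where "is = j # js" "length js = m - 1"
      by (cases "is") auto
    then show "is \<in> (\<lambda>(j, js). j # js) ` (UNIV \<times> ?L)" by auto
  qed (use assms in auto)
  have "tensor_form m A x = (\<Sum>(j, js)\<in>UNIV \<times> ?L. ?g (j # js))"
    unfolding tensor_form_def lists sum.reindex[OF inj] by (simp add: case_prod_unfold)
  also have "\<dots> = (\<Sum>j\<in>UNIV. \<Sum>js\<in>?L. ?g (j # js))"
    by (simp add: sum.cartesian_product)
  also have "\<dots> = x \<bullet> tensor_vec m A x"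
    by (simp add: inner_vec_def tensor_vec_def sum_distrib_left ac_simps)
  finally show ?thesis .
qed

text \<open>Take the inner product of the eigenvector equation with \<open>u\<close> and use that
  \<open>u\<close> is a unit vector.\<close>

lemma tensor_form_Z_eigenpair:
  assumes "m \<ge> 1" "Z_eigenpair m A l u"
  shows "tensor_form m A u = l"
  using assms by (simp add: tensor_form_eq_inner Z_eigenpair_def)

text \<open>The system has \<lambda> eliminated: \<open>form_poly\<close> stands in its place. At an
  eigenvector this form takes the value \<open>l\<close>, so the equations reduce to the eigenpair
  conditions.\<close>

lemma poly_eval_Z_system:
  assumes "m \<ge> 1" "Z_eigenpair m A l u" "h \<in> Z_system m A"
  shows "poly_eval h u = 0"
proof -
  have "u \<bullet> u = 1" "tensor_vec m A u = l *\<^sub>R u"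
    using assms(2) by (auto simp: Z_eigenpair_def)
  then show ?thesis
    using assms(3) tensor_form_Z_eigenpair[OF assms(1,2)]
    by (auto simp: Z_system_def poly_eval_diff poly_eval_sum poly_eval_mult poly_eval_form_poly
        poly_eval_vec_poly inner_vec_def)
qed

definition dirac_tms :: "nat \<Rightarrow> real^'n::finite \<Rightarrow> 'n monom \<Rightarrow> real" where
  "dirac_tms d x \<alpha> = (if \<alpha> \<in> monoms d then monom_eval x \<alpha> else 0)"

lemma dirac_tms_in_tms_space: "dirac_tms d x \<in> tms_space d"
  by (simp add: tms_space_def dirac_tms_def)

text \<open>The Dirac moments are multiplicative, so each entry factors. On its index set the matrix
  is q(x) times the rank-one matrix v v^T, with v the vector of monomials at \<open>x\<close>; only
  the value q(x) matters from here on.\<close>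

lemma localizing_matrix_dirac:
  assumes "tdeg q \<le> 2 * k"
  shows "localizing_matrix k q (dirac_tms (2 * k) x) = (\<lambda>\<alpha> \<beta>.
    if \<alpha> \<in> loc_index k q \<and> \<beta> \<in> loc_index k q
    then poly_eval q x * (monom_eval x \<alpha> * monom_eval x \<beta>) else 0)"
proof (intro ext)
  fix \<alpha> \<beta>
  show "localizing_matrix k q (dirac_tms (2 * k) x) \<alpha> \<beta> =
    (if \<alpha> \<in> loc_index k q \<and> \<beta> \<in> loc_index k q
     then poly_eval q x * (monom_eval x \<alpha> * monom_eval x \<beta>) else 0)"
  proof (cases "\<alpha> \<in> loc_index k q \<and> \<beta> \<in> loc_index k q")
    case True
    \<comment> \<open>The cut-off at degree 2k is never met: twice (2k - deg q) div 2, plus deg q,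
      is at most 2k.\<close>
    have "\<alpha> + \<beta> + \<gamma> \<in> monoms (2 * k)" if "\<gamma> \<in> Poly_Mapping.keys q" for \<gamma>
    proof -
      have "mdeg \<alpha> \<le> (2 * k - tdeg q) div 2" "mdeg \<beta> \<le> (2 * k - tdeg q) div 2"
        using True by (simp_all add: loc_index_def monoms_def)
      then show ?thesis
        using mdeg_le_tdeg[OF that] assms by (simp add: monoms_def mdeg_add)
    qed
    then show ?thesis using True
      by (simp add: localizing_matrix_eq[OF assms] loc_entries_def dirac_tms_def poly_eval_def
          riesz_def monom_eval_add sum_distrib_left sum_distrib_right ac_simps)
  qed (auto simp: localizing_matrix_eq[OF assms] loc_entries_def)
qed

text \<open>The quadratic form at \<open>v\<close> is q(x) times the square of the value at
  \<open>x\<close> of the polynomial with coefficients \<open>v\<close>.\<close>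

lemma psd_on_localizing_matrix_dirac:
  assumes "tdeg q \<le> 2 * k" "0 \<le> poly_eval q x"
  shows "psd_on (loc_index k q) (localizing_matrix k q (dirac_tms (2 * k) x))"
  unfolding psd_on_def localizing_matrix_dirac[OF assms(1)]
proof (intro conjI allI)
  fix v :: "'a monom \<Rightarrow> real"
  let ?I = "loc_index k q"
  have "(\<Sum>a\<in>?I. \<Sum>b\<in>?I. v a * (if a \<in> ?I \<and> b \<in> ?I
      then poly_eval q x * (monom_eval x a * monom_eval x b) else 0) * v b) =
    (\<Sum>a\<in>?I. \<Sum>b\<in>?I. poly_eval q x * ((v a * monom_eval x a) * (v b * monom_eval x b)))"
    by (intro sum.cong refl) (simp add: ac_simps)
  also have "\<dots> = poly_eval q x * (\<Sum>a\<in>?I. v a * monom_eval x a)\<^sup>2"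
    unfolding power2_eq_square sum_product by (simp only: sum_distrib_left)
  also have "\<dots> \<ge> 0" using assms(2) by simp
  finally show "0 \<le> (\<Sum>a\<in>?I. \<Sum>b\<in>?I. v a * (if a \<in> ?I \<and> b \<in> ?I
      then poly_eval q x * (monom_eval x a * monom_eval x b) else 0) * v b)" .
qed (simp add: ac_simps)

text \<open>At \<open>u\<close> the system vanishes and the form equals \<mu>, so the last
  localizing polynomial has the value \<mu> - l - \<delta>, which is nonnegative.\<close>

lemma dirac_tms_feasible:
  assumes "m \<ge> 1" "Z_eigenpair m A \<mu> u" "l + \<delta> \<le> \<mu>" "k0 m \<le> k"
  shows "dirac_tms (2 * k) u \<in> P_feasible m A l \<delta> k"
proof -
  \<comment> \<open>The bound m + 1 is the degree bound for the products
    \<open>form_poly m A * Var j\<close> in the system.\<close>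
  have k: "m + 1 \<le> 2 * k" using assms(4) by (simp add: k0_le_iff)
  let ?y = "dirac_tms (2 * k) u"
  have "riesz 1 ?y = 1"
    by (simp add: riesz_def dirac_tms_def monoms_def mdeg_def)
  moreover have "localizing_matrix k h ?y = (\<lambda>_ _. 0)" if "h \<in> Z_system m A" for h
  proof -
    have "tdeg h \<le> 2 * k" using tdeg_Z_system_le[OF assms(1) that] k by simp
    then show ?thesis
      by (simp add: fun_eq_iff localizing_matrix_dirac poly_eval_Z_system[OF assms(1,2) that])
  qed
  \<comment> \<open>The moment matrix is the localizing matrix of the constant 1, whose degree 0
    gives the index set \<open>monoms k\<close>.\<close>
  moreover have "psd_on (monoms k) (moment_matrix k ?y)"
    using psd_on_localizing_matrix_dirac[of 1 k u] by (simp add: moment_matrix_def loc_index_def)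
  moreover have "psd_on (loc_index k (form_poly m A - Const l - Const \<delta>))
      (localizing_matrix k (form_poly m A - Const l - Const \<delta>) ?y)"
  proof (rule psd_on_localizing_matrix_dirac)
    show "tdeg (form_poly m A - Const l - Const \<delta>) \<le> 2 * k"
      using tdeg_form_minus_le[of m A l \<delta>] k by simp
    show "0 \<le> poly_eval (form_poly m A - Const l - Const \<delta>) u"
      using assms(3)
      by (simp add: poly_eval_diff poly_eval_form_poly tensor_form_Z_eigenpair[OF assms(1,2)])
  qed
  ultimately show ?thesis
    by (simp add: P_feasible_def dirac_tms_in_tms_space)
qed

theorem theorem3p4:
  fixes A :: "'n::finite tensor" and m :: nat and \<delta> l\<^sub>i l\<^sub>m\<^sub>a\<^sub>x \<nu>\<^sub>i :: real
  assumes "m \<ge> 1" and "\<delta> > 0"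
    and "l\<^sub>i \<in> Z_eigenvalues m A"
    and "is_greatest l\<^sub>m\<^sub>a\<^sub>x (Z_eigenvalues m A)"
    and "is_greatest \<nu>\<^sub>i {z \<in> Z_eigenvalues m A. z \<le> l\<^sub>i + \<delta>}"
  shows "(isolated_Z_eigenvalue m A l\<^sub>i \<and> \<nu>\<^sub>i = l\<^sub>i \<and> l\<^sub>m\<^sub>a\<^sub>x > l\<^sub>i \<longrightarrow>
            (\<exists>\<omega>. is_least \<omega> {z \<in> Z_eigenvalues m A. z \<ge> l\<^sub>i + \<delta>} \<and>
                 is_least \<omega> {z \<in> Z_eigenvalues m A. z > l\<^sub>i})) \<and>
         (\<nu>\<^sub>i = l\<^sub>i \<and> (\<exists>k\<ge>k0 m. P_feasible m A l\<^sub>i \<delta> k = {}) \<longrightarrow> l\<^sub>i = l\<^sub>m\<^sub>a\<^sub>x)"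
proof -
  let ?Z = "Z_eigenvalues m A"
  have max: "l\<^sub>m\<^sub>a\<^sub>x \<in> ?Z" "\<And>z. z \<in> ?Z \<Longrightarrow> z \<le> l\<^sub>m\<^sub>a\<^sub>x"
    using assms(4) by (auto simp: is_greatest_def)
  \<comment> \<open>An eigenvalue at most \<open>l\<^sub>i + \<delta>\<close> competes in the
    maximum defining \<open>\<nu>\<^sub>i\<close>, hence cannot exceed
    \<open>l\<^sub>i\<close>.\<close>
  have gap: "z > l\<^sub>i + \<delta>" if "\<nu>\<^sub>i = l\<^sub>i" "z \<in> ?Z" "z > l\<^sub>i" for z
    using assms(5) that by (force simp: is_greatest_def)
  have "\<exists>\<omega>. is_least \<omega> {z \<in> ?Z. z \<ge> l\<^sub>i + \<delta>} \<and> is_least \<omega> {z \<in> ?Z. z > l\<^sub>i}"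
    if "\<nu>\<^sub>i = l\<^sub>i" "l\<^sub>m\<^sub>a\<^sub>x > l\<^sub>i"
  proof -
    have eq: "{z \<in> ?Z. z > l\<^sub>i} = {z \<in> ?Z. z \<ge> l\<^sub>i + \<delta>}"
      using gap[OF that(1)] assms(2) by force
    have "compact (?Z \<inter> {l\<^sub>i + \<delta>..})"
      by (intro compact_Int_closed compact_Z_eigenvalues assms(1) closed_atLeast)
    \<comment> \<open>The largest eigenvalue lies above \<open>l\<^sub>i\<close>, so by
      \<open>gap\<close> it belongs to this set.\<close>
    moreover have "?Z \<inter> {l\<^sub>i + \<delta>..} \<noteq> {}"
      using gap[OF that(1) max(1) that(2)] max(1) by auto
    ultimately obtain w where "w \<in> ?Z \<inter> {l\<^sub>i + \<delta>..}" "\<forall>z\<in>?Z \<inter> {l\<^sub>i + \<delta>..}. w \<le> z"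
      using compact_attains_inf by blast
    then have "is_least w {z \<in> ?Z. z \<ge> l\<^sub>i + \<delta>}" by (auto simp: is_least_def)
    then show ?thesis unfolding eq by blast
  qed
  moreover have "l\<^sub>i = l\<^sub>m\<^sub>a\<^sub>x"
    if "\<nu>\<^sub>i = l\<^sub>i" "k \<ge> k0 m" "P_feasible m A l\<^sub>i \<delta> k = {}" for k
  proof (rule ccontr)
    assume "l\<^sub>i \<noteq> l\<^sub>m\<^sub>a\<^sub>x"
    then have "l\<^sub>m\<^sub>a\<^sub>x > l\<^sub>i" using max(2)[OF assms(3)] by simp
    then have "l\<^sub>i + \<delta> \<le> l\<^sub>m\<^sub>a\<^sub>x" using gap[OF that(1) max(1)] by simp
    moreover obtain u where "Z_eigenpair m A l\<^sub>m\<^sub>a\<^sub>x u"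
      using max(1) by (auto simp: Z_eigenvalues_def)
    ultimately show False using dirac_tms_feasible[OF assms(1)] that(2,3) by blast
  qed
  ultimately show ?thesis by blast
qed

end
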